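(* Let $R$ be an integral domain of finite character. Then $R$ is a PRINC domain if and only if all invertible ideals of $R$ are principal. In particular, if $R$ is a PRINC domain of finite character which is also a Prüfer domain, then $R$ is a Bézout domain.
   Context: Two elements $a,b$ of an integral domain $R$ form an idempotent pair if either $a(1-a)\in bR$ or $b(1-b)\in aR$. $R$ is a PRINC domain (equivalently, satisfies property (princ)) if every ideal of $R$ generated by an idempotent pair is principal. An integral domain is of finite character if each of its non-zero elements is contained in only finitely many maximal ideals. A Prüfer domain is an integral domain in which every non-zero finitely generated ideal is invertible; a Bézout domain is an integral domain in which every finitely generated ideal is principal. *)

theory Defs
  imports "HOL-Computational_Algebra.Polynomial_Factorial"
begin

text \<open>
  A domain $R$ is a type \<open>'a\<close> of class \<open>idom\<close>, and its quotient field is the type \<open>'a fract\<close>.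
  Ideals are the submodules of $R$ over itself; fractional ideals are submodules of the quotient
  field over $R$. The locale \<open>module\<close> is deliberately not interpreted globally: its simp rule
  \<open>scale_scale\<close> would become the reverse of \<open>mult.assoc\<close>.
\<close>

lemma module_ring: "module ((*) :: 'a::idom \<Rightarrow> 'a \<Rightarrow> 'a)"
  by unfold_locales (simp_all add: algebra_simps)

definition frac_scale :: "'a::idom \<Rightarrow> 'a fract \<Rightarrow> 'a fract" where
  "frac_scale r x = to_fract r * x"

lemma module_frac: "module (frac_scale :: 'a::idom \<Rightarrow> 'a fract \<Rightarrow> 'a fract)"
  by unfold_locales (simp_all add: frac_scale_def algebra_simps)

abbreviation is_ideal :: "'a::idom set \<Rightarrow> bool" where
  "is_ideal \<equiv> module.subspace (*)"

abbreviation ideal_gen :: "'a::idom set \<Rightarrow> 'a set" where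
  "ideal_gen \<equiv> module.span (*)"

definition principal_ideal :: "'a::idom set \<Rightarrow> bool" where
  "principal_ideal I \<longleftrightarrow> (\<exists>a. I = ideal_gen {a})"

definition fin_gen_ideal :: "'a::idom set \<Rightarrow> bool" where
  "fin_gen_ideal I \<longleftrightarrow> (\<exists>S. finite S \<and> I = ideal_gen S)"

definition maximal_ideal :: "'a::idom set \<Rightarrow> bool" where
  "maximal_ideal M \<longleftrightarrow>
     is_ideal M \<and> M \<noteq> UNIV \<and> (\<forall>J. is_ideal J \<and> M \<subseteq> J \<longrightarrow> J = M \<or> J = UNIV)"

definition fractional_ideal :: "'a::idom fract set \<Rightarrow> bool" where
  "fractional_ideal J \<longleftrightarrow>
     module.subspace frac_scale J \<and> (\<exists>d::'a. d \<noteq> 0 \<and> (\<forall>x\<in>J. frac_scale d x \<in> range to_fract))"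

definition frac_prod :: "'a::idom fract set \<Rightarrow> 'a fract set \<Rightarrow> 'a fract set" where
  "frac_prod I J = module.span frac_scale {x * y | x y. x \<in> I \<and> y \<in> J}"

definition invertible_ideal :: "'a::idom set \<Rightarrow> bool" where
  "invertible_ideal I \<longleftrightarrow>
     is_ideal I \<and>
     (\<exists>J. fractional_ideal J \<and> frac_prod (to_fract ` I) J = range to_fract)"

text \<open>Membership of $x$ in the principal ideal $bR$ is divisibility, \<open>b dvd x\<close>.\<close>

definition idempotent_pair :: "'a::idom \<Rightarrow> 'a \<Rightarrow> bool" where
  "idempotent_pair a b \<longleftrightarrow> b dvd a * (1 - a) \<or> a dvd b * (1 - b)"

text \<open>
  The following properties of the whole ring take the carrier type as an argument, written
  \<open>TYPE('a)\<close>.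
\<close>

definition princ_domain :: "'a::idom itself \<Rightarrow> bool" where
  "princ_domain _ \<longleftrightarrow>
     (\<forall>a b::'a. idempotent_pair a b \<longrightarrow> principal_ideal (ideal_gen {a, b}))"

definition finite_character :: "'a::idom itself \<Rightarrow> bool" where
  "finite_character _ \<longleftrightarrow>
     (\<forall>x::'a. x \<noteq> 0 \<longrightarrow> finite {M. maximal_ideal M \<and> x \<in> M})"

definition pruefer_domain :: "'a::idom itself \<Rightarrow> bool" where
  "pruefer_domain _ \<longleftrightarrow>
     (\<forall>I::'a set. fin_gen_ideal I \<and> I \<noteq> {0} \<longrightarrow> invertible_ideal I)"

definition bezout_domain :: "'a::idom itself \<Rightarrow> bool" where
  "bezout_domain _ \<longleftrightarrow> (\<forall>I::'a set. fin_gen_ideal I \<longrightarrow> principal_ideal I)"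

end

theory Submission
  imports Defs
begin

text \<open>
  If \<open>b dvd a * (1 - a)\<close> and \<open>b \<noteq> 0\<close>, then \<open>(a, b) (1 - a, b) = b R\<close>, so an ideal generated by an
  idempotent pair is invertible (or visibly principal). Conversely, let \<open>I K = R\<close>. Only finitely many
  maximal ideals contain \<open>I\<close>, so a Chinese remainder argument yields \<open>b \<in> I\<close> such that \<open>b K\<close>, an
  ideal of \<open>R\<close>, lies in none of them; hence \<open>I + b K = R\<close>. Writing \<open>1 = a + a'\<close> with \<open>a \<in> I\<close> and
  \<open>a' \<in> b K\<close> gives \<open>I a' \<subseteq> b R\<close>; therefore \<open>a, b\<close> is an idempotent pair and \<open>I = (a, b)\<close>.
\<close>

section \<open>Ideals\<close>

lemmas is_ideal_def = module.subspace_def[OF module_ring]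
lemmas ideal_0 = module.subspace_0[OF module_ring]
lemmas ideal_add = module.subspace_add[OF module_ring]
lemmas ideal_mult = module.subspace_scale[OF module_ring]
lemmas ideal_diff = module.subspace_diff[OF module_ring]
lemmas ideal_sum = module.subspace_sum[OF module_ring]

lemma ideal_dvd:
  assumes "is_ideal I" "x \<in> I" "x dvd y"
  shows "y \<in> I"
  using assms ideal_mult by (metis dvd_def mult.commute)

lemma ideal_one_imp_UNIV:
  assumes "is_ideal I" "1 \<in> I"
  shows "I = UNIV"
  using ideal_dvd[OF assms] by auto

lemma ideal_gen_singleton: "ideal_gen {a} = {x. a dvd x}"
  by (auto simp: module.span_singleton[OF module_ring] dvd_def mult.commute)

text \<open>Only the coefficient of \<open>a\<close> is explicit; that of \<open>b\<close> is
  absorbed into divisibility, so membership means being congruent modulo \<open>b\<close> to a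
  multiple of \<open>a\<close>.\<close>

lemma ideal_gen_pair: "ideal_gen {a, b} = {x. \<exists>r. b dvd x - r * a}"
  by (simp add: module.span_insert[OF module_ring, of a] ideal_gen_singleton)

lemma principal_ideal_pair_dvd:
  assumes "a dvd b"
  shows "principal_ideal (ideal_gen {a, b})" "principal_ideal (ideal_gen {b, a})"
proof -
  have "a dvd x - r * b \<longleftrightarrow> a dvd x" for x r
    using assms by (metis diff_add_cancel dvd_add_left_iff dvd_mult)
  then have "ideal_gen {b, a} = ideal_gen {a}"
    by (simp add: ideal_gen_pair ideal_gen_singleton)
  then show "principal_ideal (ideal_gen {a, b})" "principal_ideal (ideal_gen {b, a})"
    unfolding principal_ideal_def by (auto simp: insert_commute)
qed

lemma is_ideal_Plus:
  assumes "is_ideal I" "is_ideal J"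
  shows "is_ideal {x + y | x y. x \<in> I \<and> y \<in> J}"
  unfolding is_ideal_def
proof (intro conjI ballI allI)
  show "0 \<in> {x + y | x y. x \<in> I \<and> y \<in> J}"
    using assms ideal_0 by force
  fix u v assume "u \<in> {x + y | x y. x \<in> I \<and> y \<in> J}" "v \<in> {x + y | x y. x \<in> I \<and> y \<in> J}"
  then obtain x y x' y' where "x \<in> I" "y \<in> J" "x' \<in> I" "y' \<in> J" "u = x + y" "v = x' + y'"
    by blast
  then show "u + v \<in> {x + y | x y. x \<in> I \<and> y \<in> J}"
    using assms by (intro CollectI exI[of _ "x + x'"] exI[of _ "y + y'"]) (simp add: ideal_add)
next
  fix c u assume "u \<in> {x + y | x y. x \<in> I \<and> y \<in> J}"
  then obtain x y where "x \<in> I" "y \<in> J" "u = x + y"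
    by blast
  then show "c * u \<in> {x + y | x y. x \<in> I \<and> y \<in> J}"
    using assms
    by (intro CollectI exI[of _ "c * x"] exI[of _ "c * y"]) (simp add: ideal_mult distrib_left)
qed

lemma is_ideal_Union_chain:
  assumes "C \<noteq> {}" "\<And>I. I \<in> C \<Longrightarrow> is_ideal I" "\<And>I J. I \<in> C \<Longrightarrow> J \<in> C \<Longrightarrow> I \<subseteq> J \<or> J \<subseteq> I"
  shows "is_ideal (\<Union>C)"
  unfolding is_ideal_def
proof (intro conjI ballI allI)
  show "0 \<in> \<Union>C"
    using assms(1,2) ideal_0 by blast
  show "c * x \<in> \<Union>C" if "x \<in> \<Union>C" for c x
    using that assms(2) ideal_mult by blast
  fix x y assume "x \<in> \<Union>C" "y \<in> \<Union>C"
  then obtain I where "I \<in> C" "x \<in> I" "y \<in> I"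
    using assms(3) by blast
  then show "x + y \<in> \<Union>C"
    using assms(2) ideal_add by blast
qed

section \<open>Existence, primeness and independence of maximal ideals\<close>

lemma ex_maximal_ideal:
  fixes I :: "'a::idom set"
  assumes "is_ideal I" "1 \<notin> I"
  obtains M where "maximal_ideal M" "I \<subseteq> M"
proof -
  let ?A = "{J. is_ideal J \<and> I \<subseteq> J \<and> 1 \<notin> J}"
  have "\<exists>M\<in>?A. \<forall>X\<in>?A. M \<subseteq> X \<longrightarrow> X = M"
  proof (rule subset_Zorn_nonempty)
    show "?A \<noteq> {}" using assms by blast
    fix C assume C: "C \<noteq> {}" "subset.chain ?A C"
    have "is_ideal (\<Union>C)"
      using C by (intro is_ideal_Union_chain) (auto simp: subset_chain_def)
    with C show "\<Union>C \<in> ?A"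
      by (auto simp: subset_chain_def)
  qed
  then obtain M where M: "is_ideal M" "I \<subseteq> M" "1 \<notin> M"
    and max: "\<And>J. is_ideal J \<Longrightarrow> I \<subseteq> J \<Longrightarrow> 1 \<notin> J \<Longrightarrow> M \<subseteq> J \<Longrightarrow> J = M"
    by auto
  have "maximal_ideal M"
    unfolding maximal_ideal_def using M max ideal_one_imp_UNIV by blast
  with M that show thesis by blast
qed

lemma maximal_ideal_one_notin:
  assumes "maximal_ideal M"
  shows "1 \<notin> M"
  using assms ideal_one_imp_UNIV unfolding maximal_ideal_def by blast

text \<open>By maximality \<open>M\<close> and \<open>x\<close> together generate the whole ring;
  multiplying an equation \<open>1 = u + x * r\<close> with \<open>u\<close> in \<open>M\<close> by
  \<open>y\<close> puts \<open>y\<close> into \<open>M\<close>.\<close>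

lemma maximal_ideal_prime:
  assumes M: "maximal_ideal M" and "x * y \<in> M" "x \<notin> M"
  shows "y \<in> M"
proof -
  have iM: "is_ideal M"
    using M by (simp add: maximal_ideal_def)
  let ?J = "{u + v | u v. u \<in> M \<and> v \<in> ideal_gen {x}}"
  have J: "is_ideal ?J"
    using iM by (intro is_ideal_Plus module.subspace_span[OF module_ring])
  have "M \<subseteq> ?J"
  proof
    fix u assume "u \<in> M"
    then show "u \<in> ?J"
      by (intro CollectI exI[of _ u] exI[of _ 0]) (simp add: ideal_gen_singleton)
  qed
  moreover have "x \<in> ?J"
    using ideal_0[OF iM] by (intro CollectI exI[of _ x] exI[of _ 0]) (simp add: ideal_gen_singleton)
  ultimately have "?J = UNIV"
    using M J \<open>x \<notin> M\<close> unfolding maximal_ideal_def by blast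
  then have "1 \<in> ?J" by simp
  then obtain u r where "u \<in> M" "1 = u + x * r"
    by (auto simp: ideal_gen_singleton dvd_def)
  then have "y = y * u + r * (x * y)"
    by (metis distrib_left mult.commute mult.left_commute mult.right_neutral)
  then show ?thesis
    using iM \<open>u \<in> M\<close> \<open>x * y \<in> M\<close> ideal_add ideal_mult by metis
qed

lemma maximal_ideal_prod_notin:
  assumes M: "maximal_ideal M" and "finite A" "\<And>x. x \<in> A \<Longrightarrow> f x \<notin> M"
  shows "prod f A \<notin> M"
  using assms(2,3)
proof (induction rule: finite_induct)
  case empty
  then show ?case using maximal_ideal_one_notin[OF M] by simp
next
  case (insert x A)
  then show ?case using maximal_ideal_prime[OF M, of "f x" "prod f A"] by auto
qed

text \<open>Distinct maximal ideals are incomparable, so each other \<open>N\<close> has an element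
  outside \<open>M\<close>; the product of these lies in every such \<open>N\<close> and,
  \<open>M\<close> being prime, not in \<open>M\<close>. Such elements are the weights of the
  Chinese remainder argument.\<close>

lemma ex_in_other_maximal_ideals:
  assumes F: "finite F" "\<And>N. N \<in> F \<Longrightarrow> maximal_ideal N" and M: "M \<in> F"
  shows "\<exists>c. c \<notin> M \<and> (\<forall>N\<in>F - {M}. c \<in> N)"
proof -
  have "\<exists>d. d \<in> N \<and> d \<notin> M" if "N \<in> F - {M}" for N
  proof -
    have "\<not> N \<subseteq> M"
      using F(2)[of N] F(2)[OF M] that unfolding maximal_ideal_def by blast
    then show ?thesis by blast
  qed
  then obtain d where d: "\<And>N. N \<in> F - {M} \<Longrightarrow> d N \<in> N \<and> d N \<notin> M"
    by metis
  have "prod d (F - {M}) \<notin> M"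
    using F M d by (intro maximal_ideal_prod_notin) auto
  moreover have "prod d (F - {M}) \<in> N" if "N \<in> F - {M}" for N
  proof (rule ideal_dvd)
    show "is_ideal N" using F(2) that by (simp add: maximal_ideal_def)
    show "d N \<in> N" using d that by blast
    show "d N dvd prod d (F - {M})" using F that by (simp add: dvd_prodI)
  qed
  ultimately show ?thesis by blast
qed

section \<open>Invertible ideals\<close>

lemma idempotent_pair_imp_invertible_ideal:
  fixes a b :: "'a::idom"
  assumes dvd: "b dvd a * (1 - a)" and "b \<noteq> 0"
  shows "invertible_ideal (ideal_gen {a, b})"
proof -
  let ?I = "ideal_gen {a, b}"
  \<comment> \<open>The candidate inverse is the colon module of all \<open>y\<close> that multiply
    the ideal into the ring; it suffices to test the two generators.\<close>
  let ?J = "{y. to_fract a * y \<in> range to_fract \<and> to_fract b * y \<in> range to_fract}"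
  have R: "module.subspace frac_scale (range (to_fract :: 'a \<Rightarrow> 'a fract))"
    unfolding module.subspace_def[OF module_frac] frac_scale_def
    by (auto simp flip: to_fract_0 to_fract_add to_fract_mult)
  have add: "x + y \<in> range to_fract" if "x \<in> range to_fract" "y \<in> range to_fract" for x y :: "'a fract"
    using module.subspace_add[OF module_frac R] that .
  have scale: "to_fract c * x \<in> range to_fract" if "x \<in> range to_fract" for c :: 'a and x
    using module.subspace_scale[OF module_frac R that] by (simp add: frac_scale_def)
  have "module.subspace frac_scale ?J"
    unfolding module.subspace_def[OF module_frac] frac_scale_def
    using add scale module.subspace_0[OF module_frac R]
    by (auto simp: distrib_left mult.left_commute)
  \<comment> \<open>The generator \<open>b\<close> itself is a common denominator for
    \<open>?J\<close>.\<close>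
  then have "fractional_ideal ?J"
    unfolding fractional_ideal_def using \<open>b \<noteq> 0\<close> by (auto simp: frac_scale_def)
  moreover have "frac_prod (to_fract ` ?I) ?J = range to_fract"
  proof
    have "to_fract x * y \<in> range to_fract" if x: "x \<in> ?I" and y: "y \<in> ?J" for x y
    proof -
      obtain r s where "x = r * a + s * b"
        using x by (auto simp: ideal_gen_pair dvd_def algebra_simps)
      then have "to_fract x * y = to_fract r * (to_fract a * y) + to_fract s * (to_fract b * y)"
        by (simp add: algebra_simps)
      with y show ?thesis using add scale by (metis (no_types, lifting) mem_Collect_eq)
    qed
    then show "frac_prod (to_fract ` ?I) ?J \<subseteq> range to_fract"
      unfolding frac_prod_def by (intro module.span_minimal[OF module_frac _ R]) auto
  next
    have sub: "module.subspace frac_scale (frac_prod (to_fract ` ?I) ?J)"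
      unfolding frac_prod_def by (rule module.subspace_span[OF module_frac])
    have prod: "to_fract x * y \<in> frac_prod (to_fract ` ?I) ?J" if "x \<in> ?I" "y \<in> ?J" for x y
      unfolding frac_prod_def using that by (intro module.span_base[OF module_frac]) blast
    \<comment> \<open>With this \<open>z\<close>, the sum \<open>a * 1 + b * z\<close> equals 1,
      which shows that the product is the whole ring. The assumed divisibility is exactly what
      places \<open>a * z\<close> in the ring, hence \<open>z\<close> in \<open>?J\<close>.\<close>
    define z where "z = to_fract (1 - a) / to_fract b"
    obtain c where c: "a * (1 - a) = b * c"
      using dvd by (auto simp: dvd_def)
    have "to_fract a * z = to_fract (a * (1 - a)) / to_fract b"
      by (simp add: z_def)
    then have "to_fract a * z = to_fract c"
      unfolding c using \<open>b \<noteq> 0\<close> by simp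
    moreover have bz: "to_fract b * z = to_fract (1 - a)"
      unfolding z_def using \<open>b \<noteq> 0\<close> by simp
    ultimately have "z \<in> ?J" by (simp del: to_fract_diff)
    moreover have "a \<in> ?I" "b \<in> ?I"
      by (auto intro: module.span_base[OF module_ring])
    moreover have "1 \<in> ?J" by simp
    ultimately have "to_fract a * 1 + to_fract b * z \<in> frac_prod (to_fract ` ?I) ?J"
      using prod by (intro module.subspace_add[OF module_frac sub])
    then have "1 \<in> frac_prod (to_fract ` ?I) ?J"
      by (simp add: bz)
    from module.subspace_scale[OF module_frac sub this]
    show "range to_fract \<subseteq> frac_prod (to_fract ` ?I) ?J"
      by (auto simp: frac_scale_def)
  qed
  ultimately show ?thesis
    unfolding invertible_ideal_def by (auto intro: module.subspace_span[OF module_ring])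
qed

lemma principal_if_idempotent_pair:
  fixes a b :: "'a::idom"
  assumes inv: "\<And>I::'a set. invertible_ideal I \<Longrightarrow> principal_ideal I" and dvd: "b dvd a * (1 - a)"
  shows "principal_ideal (ideal_gen {a, b})"
proof (cases "b = 0")
  case True
  \<comment> \<open>Every element divides 0, so \<open>a\<close> alone generates the ideal. The case
    is separate because the zero ideal, which arises for \<open>a = 0\<close>, is principal but not
    invertible.\<close>
  then show ?thesis by (simp add: principal_ideal_pair_dvd)
next
  case False
  then show ?thesis using idempotent_pair_imp_invertible_ideal[OF dvd] inv by blast
qed

section \<open>Invertible ideals against finitely many maximal ideals\<close>

lemma frac_prod_memE:
  assumes "frac_prod (to_fract ` I) K = range to_fract" "x \<in> I" "y \<in> K"
  obtains r where "to_fract x * y = to_fract r"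
proof -
  have "to_fract x * y \<in> frac_prod (to_fract ` I) K"
    unfolding frac_prod_def using assms(2,3) by (intro module.span_base[OF module_frac]) blast
  with assms(1) that show thesis by auto
qed

lemma invertible_ideal_not_in_maximal:
  assumes I: "frac_prod (to_fract ` I) K = range to_fract" and M: "maximal_ideal M"
  obtains x y r where "x \<in> I" "y \<in> K" "to_fract x * y = to_fract r" "r \<notin> M"
proof (rule ccontr)
  assume "\<not> thesis"
  with that have *: "r \<in> M" if "x \<in> I" "y \<in> K" "to_fract x * y = to_fract r" for x y r
    using that by blast
  have iM: "is_ideal M"
    using M by (simp add: maximal_ideal_def)
  have "frac_prod (to_fract ` I) K \<subseteq> to_fract ` M"
    unfolding frac_prod_def
  proof (rule module.span_minimal[OF module_frac])
    show "module.subspace frac_scale (to_fract ` M)"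
      unfolding module.subspace_def[OF module_frac] frac_scale_def
      using iM ideal_0[OF iM] ideal_add[OF iM] ideal_mult[OF iM]
      by (auto simp flip: to_fract_0 to_fract_add to_fract_mult)
    show "{x * y | x y. x \<in> to_fract ` I \<and> y \<in> K} \<subseteq> to_fract ` M"
    proof clarify
      fix x y assume xy: "x \<in> I" "y \<in> K"
      with I obtain r where "to_fract x * y = to_fract r"
        by (rule frac_prod_memE)
      with * xy show "to_fract x * y \<in> to_fract ` M" by auto
    qed
  qed
  with I have "to_fract 1 \<in> to_fract ` M" by blast
  then show False
    using maximal_ideal_one_notin[OF M] by (auto simp del: to_fract_1)
qed

text \<open>A local choice \<open>x M\<close> for each \<open>M\<close> is glued into one
  \<open>b\<close> with weights \<open>c M\<close> that avoid \<open>M\<close> but lie in all other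
  members of \<open>F\<close>. Modulo \<open>M\<close>, only the summand belonging to
  \<open>M\<close> survives.\<close>

lemma ex_multiplier_avoiding_maximal_ideals:
  assumes I: "is_ideal I" "frac_prod (to_fract ` I) K = range to_fract"
    and F: "finite F" "\<And>M. M \<in> F \<Longrightarrow> maximal_ideal M"
  obtains b where "b \<in> I" "\<And>M. M \<in> F \<Longrightarrow> \<exists>y\<in>K. \<exists>r. to_fract b * y = to_fract r \<and> r \<notin> M"
proof -
  have "\<forall>M\<in>F. \<exists>c. c \<notin> M \<and> (\<forall>N\<in>F - {M}. c \<in> N)"
    using ex_in_other_maximal_ideals[OF F] by blast
  then obtain c where c: "\<And>M. M \<in> F \<Longrightarrow> c M \<notin> M" "\<And>M N. M \<in> F \<Longrightarrow> N \<in> F \<Longrightarrow> N \<noteq> M \<Longrightarrow> c M \<in> N"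
    by (metis DiffI singletonD)
  have "\<forall>M\<in>F. \<exists>x. x \<in> I \<and> (\<exists>y\<in>K. \<exists>r. to_fract x * y = to_fract r \<and> r \<notin> M)"
    using invertible_ideal_not_in_maximal[OF I(2) F(2)] by metis
  then obtain x where x: "\<And>M. M \<in> F \<Longrightarrow> x M \<in> I"
      "\<And>M. M \<in> F \<Longrightarrow> \<exists>y\<in>K. \<exists>r. to_fract (x M) * y = to_fract r \<and> r \<notin> M"
    by metis
  define b where "b = (\<Sum>M\<in>F. c M * x M)"
  have "b \<in> I"
    unfolding b_def using I(1) x(1) by (intro ideal_sum ideal_mult)
  moreover have "\<exists>y\<in>K. \<exists>r. to_fract b * y = to_fract r \<and> r \<notin> M" if M: "M \<in> F" for M
  proof -
    have iM: "is_ideal M"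
      using F(2)[OF M] by (simp add: maximal_ideal_def)
    \<comment> \<open>The \<open>y\<close> chosen for this \<open>M\<close> is kept for all summands
      of \<open>b\<close>: it multiplies every \<open>x N\<close> into the ring because
      \<open>x N\<close> is in \<open>I\<close>.\<close>
    obtain y r where y: "y \<in> K" "to_fract (x M) * y = to_fract r" "r \<notin> M"
      using x(2)[OF M] by blast
    have "\<exists>s. to_fract (x N) * y = to_fract s" if "N \<in> F" for N
      using frac_prod_memE[OF I(2) x(1)[OF that] y(1)] by blast
    then obtain s where s: "\<And>N. N \<in> F \<Longrightarrow> to_fract (x N) * y = to_fract (s N)"
      by metis
    have "s M = r"
      using s[OF M] y(2) by simp
    \<comment> \<open>\<open>t\<close> collects the summands for \<open>N\<close> other than
      \<open>M\<close>; each has a factor \<open>c N\<close> in \<open>M\<close>.\<close>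
    define t where "t = (\<Sum>N\<in>F - {M}. c N * s N)"
    have "t \<in> M"
      unfolding t_def
      by (intro ideal_sum[OF iM] ideal_dvd[OF iM c(2)[OF _ M]]) auto
    have "to_fract b * y = (\<Sum>N\<in>F. to_fract (c N) * (to_fract (x N) * y))"
      by (simp add: b_def sum_distrib_right mult.assoc)
    also have "\<dots> = to_fract (\<Sum>N\<in>F. c N * s N)"
      by (simp add: s)
    also have "(\<Sum>N\<in>F. c N * s N) = c M * r + t"
      unfolding t_def using F(1) M \<open>s M = r\<close> by (simp add: sum.remove)
    finally have "to_fract b * y = to_fract (c M * r + t)" .
    moreover have "c M * r + t \<notin> M"
    proof
      assume "c M * r + t \<in> M"
      with ideal_diff[OF iM this \<open>t \<in> M\<close>] have "c M * r \<in> M" by simp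
      with maximal_ideal_prime[OF F(2)[OF M]] c(1)[OF M] y(3) show False by blast
    qed
    ultimately show ?thesis using y(1) by blast
  qed
  ultimately show thesis using that by blast
qed

section \<open>Generating an invertible ideal by an idempotent pair\<close>

lemma invertible_ideal_idempotent_pair:
  fixes I :: "'a::idom set"
  assumes fc: "finite_character TYPE('a)" and inv: "invertible_ideal I"
  obtains a b where "idempotent_pair a b" "I = ideal_gen {a, b}"
proof -
  obtain K where iI: "is_ideal I" and K: "module.subspace frac_scale K"
    and IK: "frac_prod (to_fract ` I) K = range to_fract"
    using inv unfolding invertible_ideal_def fractional_ideal_def by blast
  \<comment> \<open>Finite character speaks of non-zero elements, so one is needed in
    \<open>I\<close> to bound \<open>F\<close>; the zero ideal would have zero product with
    \<open>K\<close>.\<close>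
  have "\<exists>x\<in>I. x \<noteq> 0"
  proof (rule ccontr)
    assume "\<not> ?thesis"
    then have "frac_prod (to_fract ` I) K \<subseteq> {0}"
      unfolding frac_prod_def
      by (intro module.span_minimal[OF module_frac] module.subspace_single_0[OF module_frac]) auto
    with IK have "to_fract (1::'a) \<in> {0}" by blast
    then show False by simp
  qed
  then obtain x0 where x0: "x0 \<in> I" "x0 \<noteq> 0" by blast
  define F where "F = {M. maximal_ideal M \<and> I \<subseteq> M}"
  have "finite F"
    by (rule finite_subset[of _ "{M. maximal_ideal M \<and> x0 \<in> M}"])
      (use fc x0 in \<open>auto simp: F_def finite_character_def\<close>)
  moreover have "maximal_ideal M" if "M \<in> F" for M
    using that by (simp add: F_def)
  ultimately have "\<exists>b\<in>I. \<forall>M\<in>F. \<exists>y\<in>K. \<exists>r. to_fract b * y = to_fract r \<and> r \<notin> M"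
    by (rule ex_multiplier_avoiding_maximal_ideals[OF iI IK]) (blast+)
  \<comment> \<open>If \<open>I\<close> is the whole ring, \<open>F\<close> is empty and
    \<open>b\<close> may be 0; the steps below cover this case too.\<close>
  then obtain b where b: "b \<in> I"
      "\<And>M. M \<in> F \<Longrightarrow> \<exists>y\<in>K. \<exists>r. to_fract b * y = to_fract r \<and> r \<notin> M"
    by blast
  \<comment> \<open>This is \<open>b K\<close>, which lies in the ring since \<open>b\<close> is in
    \<open>I\<close>, pulled back along \<open>to_fract\<close>.\<close>
  define J where "J = {r. \<exists>y\<in>K. to_fract r = to_fract b * y}"
  have iJ: "is_ideal J"
    unfolding is_ideal_def
  proof (intro conjI ballI allI)
    show "0 \<in> J"
      unfolding J_def using module.subspace_0[OF module_frac K]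
      by (intro CollectI bexI[of _ 0]) simp_all
    fix r s assume "r \<in> J" "s \<in> J"
    then show "r + s \<in> J"
      unfolding J_def using module.subspace_add[OF module_frac K]
      by (auto simp flip: distrib_left)
  next
    fix c r assume "r \<in> J"
    then obtain y where "y \<in> K" "to_fract r = to_fract b * y"
      by (auto simp: J_def)
    then show "c * r \<in> J"
      unfolding J_def using module.subspace_scale[OF module_frac K, of y c]
      by (auto simp: frac_scale_def mult.left_commute)
  qed
  \<comment> \<open>If \<open>r = b * y\<close> with \<open>y\<close> in \<open>K\<close>, then
    \<open>x * r = b * (x * y)\<close>, and \<open>x * y\<close> lies in the ring.\<close>
  have IJ: "b dvd x * r" if "x \<in> I" "r \<in> J" for x r
  proof -
    obtain y where y: "y \<in> K" "to_fract r = to_fract b * y"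
      using \<open>r \<in> J\<close> by (auto simp: J_def)
    obtain s where "to_fract x * y = to_fract s"
      using frac_prod_memE[OF IK \<open>x \<in> I\<close> y(1)] .
    with y(2) have "to_fract (x * r) = to_fract (b * s)"
      by (simp add: mult.left_commute)
    then show ?thesis by (simp only: to_fract_eq_iff) simp
  qed
  let ?S = "{x + y | x y. x \<in> I \<and> y \<in> J}"
  have iS: "is_ideal ?S"
    by (rule is_ideal_Plus[OF iI iJ])
  \<comment> \<open>A maximal ideal above \<open>I + J\<close> would belong to \<open>F\<close>, but
    \<open>b\<close> was chosen so that \<open>J\<close> leaves every member of
    \<open>F\<close>.\<close>
  have "1 \<in> ?S"
  proof (rule ccontr)
    assume "1 \<notin> ?S"
    then obtain M where M: "maximal_ideal M" "?S \<subseteq> M"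
      using ex_maximal_ideal[OF iS] by blast
    have "I \<subseteq> ?S"
    proof
      fix x assume "x \<in> I"
      then show "x \<in> ?S"
        using ideal_0[OF iJ] by (intro CollectI exI[of _ x] exI[of _ 0]) simp
    qed
    moreover have "J \<subseteq> ?S"
    proof
      fix x assume "x \<in> J"
      then show "x \<in> ?S"
        using ideal_0[OF iI] by (intro CollectI exI[of _ 0] exI[of _ x]) simp
    qed
    ultimately have "I \<subseteq> M" "J \<subseteq> M"
      using M(2) by blast+
    then obtain y r where "y \<in> K" "to_fract b * y = to_fract r" "r \<notin> M"
      using b(2) M(1) unfolding F_def by blast
    moreover from this have "r \<in> J"
      unfolding J_def by (intro CollectI bexI[of _ y]) simp_all
    ultimately show False
      using \<open>J \<subseteq> M\<close> by blast
  qed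
  then obtain a a' where a: "a \<in> I" "a' \<in> J" "1 = a + a'" by blast
  then have a': "1 - a \<in> J"
    by (metis add_diff_cancel_left')
  have "idempotent_pair a b"
    unfolding idempotent_pair_def using IJ[OF a(1) a'] by blast
  moreover have "I = ideal_gen {a, b}"
  proof
    show "I \<subseteq> ideal_gen {a, b}"
    proof
      fix x assume "x \<in> I"
      \<comment> \<open>In \<open>x = x * a + x * (1 - a)\<close> the last term is divisible by
        \<open>b\<close>, so the coefficient of \<open>a\<close> is \<open>x\<close> itself.\<close>
      from IJ[OF this a'] show "x \<in> ideal_gen {a, b}"
        by (auto simp: ideal_gen_pair algebra_simps)
    qed
    show "ideal_gen {a, b} \<subseteq> I"
      using a(1) b(1) iI by (intro module.span_minimal[OF module_ring]) auto
  qed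
  ultimately show thesis using that by blast
qed

theorem corollary1p7:
  assumes "finite_character TYPE('a::idom)"
  shows "(princ_domain TYPE('a) \<longleftrightarrow>
           (\<forall>I::'a set. invertible_ideal I \<longrightarrow> principal_ideal I)) \<and>
         (princ_domain TYPE('a) \<and> pruefer_domain TYPE('a) \<longrightarrow> bezout_domain TYPE('a))"
proof -
  have 1: "\<forall>I::'a set. invertible_ideal I \<longrightarrow> principal_ideal I" if "princ_domain TYPE('a)"
    using that invertible_ideal_idempotent_pair[OF assms] unfolding princ_domain_def by metis
  have 2: "princ_domain TYPE('a)" if "\<forall>I::'a set. invertible_ideal I \<longrightarrow> principal_ideal I"
    unfolding princ_domain_def idempotent_pair_def
    \<comment> \<open>The two alternatives in \<open>idempotent_pair\<close> differ by exchanging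
      \<open>a\<close> and \<open>b\<close>, which leaves the generated ideal unchanged.\<close>
    using that principal_if_idempotent_pair by (metis insert_commute)
  \<comment> \<open>The Pruefer condition only concerns non-zero ideals, so the zero ideal is
    treated directly.\<close>
  have "principal_ideal {0::'a}"
    unfolding principal_ideal_def by (intro exI[of _ 0]) (auto simp: ideal_gen_singleton)
  then have "bezout_domain TYPE('a)" if "princ_domain TYPE('a)" "pruefer_domain TYPE('a)"
    using 1[OF that(1)] that(2) unfolding bezout_domain_def pruefer_domain_def by metis
  with 1 2 show ?thesis by blast
qed

end
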